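(* Every graph with layered pathwidth $\ell$ has track-number at most $3\ell$.
   Context: Graphs are finite, simple and undirected. A path decomposition of a graph is a sequence of vertex subsets (bags) such that each vertex belongs to a nonempty contiguous subsequence of bags and every two adjacent vertices have at least one bag in common. A layering of a graph is a partition of its vertices into a sequence of disjoint subsets (layers) such that each edge joins vertices in the same layer or in consecutive layers. The layered pathwidth of a graph $G$ is the minimum integer $k$ such that for some path decomposition and some layering of $G$, the intersection of each bag with each layer has at most $k$ vertices. A $k$-track layout of a graph is a partition of its vertex set into $k$ sequences, called tracks, such that the vertices in each track form an independent set and the edges between each pair of tracks form a non-crossing set; that is, there are no edges $uv$ and $u'v'$ such that $u$ is before $u'$ in one track but $v$ is after $v'$ in another track. The track-number of a graph is the minimum number of tracks in a track layout of it. *)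

theory Defs
  imports "Graph_Theory.Digraph"
begin

text \<open>
  A finite simple undirected graph is an instance of the locale \<^locale>\<open>graph\<close>: a finite,
  loop-free, symmetric digraph without parallel arcs. Adjacency of \<open>u\<close> and \<open>v\<close> is
  \<open>(u, v) \<in> arcs_ends G\<close>, written \<open>u \<rightarrow> v\<close> with subscript \<open>G\<close>. The null graph is allowed.
\<close>

definition path_decomposition :: "('a, 'b) pre_digraph \<Rightarrow> 'a set list \<Rightarrow> bool" where
  "path_decomposition G B \<longleftrightarrow>
     (\<forall>X \<in> set B. X \<subseteq> verts G) \<and>
     (\<forall>v \<in> verts G. \<exists>i j. i \<le> j \<and> {k. k < length B \<and> v \<in> B ! k} = {i..j}) \<and>
     (\<forall>u v. u \<rightarrow>\<^bsub>G\<^esub> v \<longrightarrow> (\<exists>X \<in> set B. u \<in> X \<and> v \<in> X))"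

text \<open>
  Layers and tracks may be empty. Deleting the empty ones preserves all conditions below,
  so this does not affect the two minima.
\<close>

definition layering :: "('a, 'b) pre_digraph \<Rightarrow> 'a set list \<Rightarrow> bool" where
  "layering G L \<longleftrightarrow>
     \<Union>(set L) = verts G \<and>
     (\<forall>i < length L. \<forall>j < length L. i \<noteq> j \<longrightarrow> L ! i \<inter> L ! j = {}) \<and>
     (\<forall>u v. u \<rightarrow>\<^bsub>G\<^esub> v \<longrightarrow>
        (\<forall>i < length L. \<forall>j < length L. u \<in> L ! i \<longrightarrow> v \<in> L ! j \<longrightarrow>
           i = j \<or> j = Suc i \<or> i = Suc j))"

definition layered_width_at_most :: "('a, 'b) pre_digraph \<Rightarrow> nat \<Rightarrow> bool" where
  "layered_width_at_most G k \<longleftrightarrow>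
     (\<exists>B L. path_decomposition G B \<and> layering G L \<and>
        (\<forall>X \<in> set B. \<forall>Y \<in> set L. card (X \<inter> Y) \<le> k))"

definition layered_pathwidth :: "('a, 'b) pre_digraph \<Rightarrow> nat" where
  "layered_pathwidth G = (LEAST k. layered_width_at_most G k)"

definition before_in :: "'a list \<Rightarrow> 'a \<Rightarrow> 'a \<Rightarrow> bool" where
  "before_in t x y \<longleftrightarrow> (\<exists>i j. i < j \<and> j < length t \<and> t ! i = x \<and> t ! j = y)"

definition track_layout :: "('a, 'b) pre_digraph \<Rightarrow> nat \<Rightarrow> 'a list list \<Rightarrow> bool" where
  "track_layout G k T \<longleftrightarrow>
     length T = k \<and>
     distinct (concat T) \<and> set (concat T) = verts G \<and>
     (\<forall>t \<in> set T. \<forall>u \<in> set t. \<forall>v \<in> set t. \<not> u \<rightarrow>\<^bsub>G\<^esub> v) \<and>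
     (\<forall>i < k. \<forall>j < k. i \<noteq> j \<longrightarrow>
        \<not> (\<exists>u v u' v'. u \<rightarrow>\<^bsub>G\<^esub> v \<and> u' \<rightarrow>\<^bsub>G\<^esub> v' \<and>
             before_in (T ! i) u u' \<and> before_in (T ! j) v' v))"

definition track_number :: "('a, 'b) pre_digraph \<Rightarrow> nat" where
  "track_number G = (LEAST k. \<exists>T. track_layout G k T)"

text \<open>Both minima are taken over nonempty sets, so they are attained.\<close>

lemma layered_width_at_most_layered_pathwidth:
  assumes "graph G"
  shows "layered_width_at_most G (layered_pathwidth G)"
proof -
  interpret graph G by (rule assms)
  have "{k. k < length [verts G] \<and> v \<in> [verts G] ! k} = {0..0}" if "v \<in> verts G" for v
    using that by auto
  then have "path_decomposition G [verts G]"
    unfolding path_decomposition_def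
    by (auto simp: arcs_ends_def arc_to_ends_def)
       (metis le_refl atLeastAtMost_singleton)+
  moreover have "layering G [verts G]"
    by (auto simp: layering_def)
  ultimately have "layered_width_at_most G (card (verts G))"
    unfolding layered_width_at_most_def by (intro exI[of _ "[verts G]"]) auto
  then show ?thesis
    unfolding layered_pathwidth_def by (rule LeastI)
qed

lemma track_layout_track_number:
  assumes "graph G"
  shows "\<exists>T. track_layout G (track_number G) T"
proof -
  interpret graph G by (rule assms)
  obtain xs where xs: "distinct xs" "set xs = verts G"
    using finite_distinct_list[OF finite_verts] by blast
  have "\<not> u \<rightarrow>\<^bsub>G\<^esub> u" for u
    using no_loops by (auto simp: arcs_ends_def arc_to_ends_def)
  then have "track_layout G (length xs) (map (\<lambda>x. [x]) xs)"
    using xs by (auto simp: track_layout_def before_in_def)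
  then show ?thesis
    unfolding track_number_def by (intro LeastI) blast
qed

end

theory Submission
  imports Defs
begin

text \<open>
  Fix a path decomposition and a layering that witness layered pathwidth \<open>l\<close>. The bags that
  contain a vertex form an interval of indices, adjacent vertices have intersecting intervals,
  and at most \<open>l\<close> intervals of one layer share a point. Interval graphs are perfect, so
  each layer can be coloured with \<open>l\<close> colours such that the intervals of one colour are
  pairwise disjoint (\<open>interval_colouring\<close>).

  The track of a vertex is given by its colour and by its layer modulo 3, and each track is
  ordered by layer first and by left endpoint second (\<open>track_layout_of_ordered_colouring\<close>
  turns such data into lists). Adjacent vertices in one track would lie in the same layer,
  because their layers differ by at most 1 and agree modulo 3; but then their equal colours would
  make their intervals disjoint. So tracks are independent.

  Suppose that \<open>uv\<close> and \<open>u'v'\<close> cross, so \<open>u\<close> precedes \<open>u'\<close> in one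
  track and \<open>v'\<close> precedes \<open>v\<close> in another. If \<open>u\<close> and \<open>u'\<close> were in different layers, then
  \<open>u'\<close> would lie at least three layers later, hence \<open>v'\<close> in a later layer than \<open>v\<close>, which the
  order of their track forbids. So \<open>u\<close> and \<open>u'\<close> share a layer, and symmetrically so do \<open>v\<close> and
  \<open>v'\<close>. Then the interval of \<open>u\<close> lies entirely to the left of that of \<open>u'\<close>, and the interval of
  \<open>v'\<close> entirely to the left of that of \<open>v\<close>. A bag containing \<open>u\<close> and \<open>v\<close> would come both before
  and after a bag containing \<open>u'\<close> and \<open>v'\<close>, which is impossible.
\<close>

text \<open>
  Greedy colouring by increasing left endpoint: every earlier interval that meets the new one
  contains its left endpoint, so together with the new interval these number at most \<open>l\<close>, and
  a colour is free.
\<close>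

lemma interval_colouring:
  fixes a b :: "'a \<Rightarrow> 'i :: linorder"
  assumes "finite S"
    and "\<And>v. v \<in> S \<Longrightarrow> a v \<le> b v"
    and "\<And>k. card {v \<in> S. k \<in> {a v..b v}} \<le> l"
  shows "\<exists>c. (\<forall>v \<in> S. c v < l) \<and>
           (\<forall>u \<in> S. \<forall>v \<in> S. u \<noteq> v \<longrightarrow> c u = c v \<longrightarrow> {a u..b u} \<inter> {a v..b v} = {})"
  using assms
proof (induction S rule: finite_ranking_induct[where f = a])
  case empty
  show ?case by simp
next
  case (insert x S)
  show ?case
  proof (cases "x \<in> S")
    case True
    then show ?thesis using insert by (simp add: insert_absorb)
  next
    case False
    have "card {v \<in> S. k \<in> {a v..b v}} \<le> l" for k
    proof -
      have "card {v \<in> S. k \<in> {a v..b v}} \<le> card {v \<in> insert x S. k \<in> {a v..b v}}"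
        using insert.hyps by (intro card_mono) auto
      also have "\<dots> \<le> l" by (rule insert.prems(2))
      finally show ?thesis .
    qed
    then obtain c where c: "\<forall>v \<in> S. c v < l"
      "\<forall>u \<in> S. \<forall>v \<in> S. u \<noteq> v \<longrightarrow> c u = c v \<longrightarrow> {a u..b u} \<inter> {a v..b v} = {}"
      using insert.IH[OF insert.prems(1)] by auto
    let ?N = "{v \<in> S. a x \<in> {a v..b v}}"
    have "{v \<in> insert x S. a x \<in> {a v..b v}} = insert x ?N"
      using insert.prems(1) by auto
    then have "card (insert x ?N) \<le> l"
      using insert.prems(2)[of "a x"] by simp
    then have "card ?N < l"
      using False insert.hyps(1) by simp
    then have "card (c ` ?N) < card {..<l}"
      using card_image_le[of ?N c] insert.hyps(1) by simp
    moreover have "finite (c ` ?N)"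
      using insert.hyps(1) by simp
    ultimately have "\<not> {..<l} \<subseteq> c ` ?N"
      by (metis card_mono not_le)
    then obtain d where d: "d < l" "d \<notin> c ` ?N"
      by blast
    have disj: "{a v..b v} \<inter> {a x..b x} = {}" if "v \<in> S" "c v = d" for v
    proof -
      have "\<not> a x \<le> b v"
        using that d(2) insert.hyps(2) by auto
      then show ?thesis by auto
    qed
    show ?thesis
    proof (intro exI[of _ "c(x := d)"] conjI)
      show "\<forall>v \<in> insert x S. (c(x := d)) v < l"
        using c(1) d(1) by auto
      show "\<forall>u \<in> insert x S. \<forall>v \<in> insert x S. u \<noteq> v \<longrightarrow> (c(x := d)) u = (c(x := d)) v \<longrightarrow>
              {a u..b u} \<inter> {a v..b v} = {}"
        using c(2) disj by (auto simp: Int_commute simp del: atLeastatMost_empty_iff Int_atLeastAtMost)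
    qed
  qed
qed

lemma before_in_sort_keyD:
  assumes "before_in (sort_key f xs) x y" "distinct xs"
  shows "x \<in> set xs" "y \<in> set xs" "x \<noteq> y" "f x \<le> f y"
proof -
  let ?s = "sort_key f xs"
  obtain i j where ij: "i < j" "j < length ?s" "?s ! i = x" "?s ! j = y"
    using assms(1) unfolding before_in_def by blast
  show "x \<in> set xs" "y \<in> set xs"
    using ij by (metis less_trans nth_mem set_sort)+
  show "x \<noteq> y"
    using ij assms(2) by (metis distinct_sort less_trans nat_neq_iff nth_eq_iff_index_eq)
  have "map f ?s ! i \<le> map f ?s ! j"
    using ij by (intro sorted_nth_mono) auto
  then show "f x \<le> f y"
    using ij by auto
qed

text \<open>
  A track layout can be given by functions on vertices: \<open>tr\<close> names the track and \<open>key\<close>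
  orders it. Ties in \<open>key\<close> are broken arbitrarily, so the crossing condition is required for
  either order of tied vertices.
\<close>

lemma track_layout_of_ordered_colouring:
  fixes key :: "'a \<Rightarrow> 'k :: linorder"
  assumes "finite (verts G)"
    and tr: "\<And>v. v \<in> verts G \<Longrightarrow> tr v < k"
    and indep: "\<And>u v. u \<in> verts G \<Longrightarrow> v \<in> verts G \<Longrightarrow> u \<rightarrow>\<^bsub>G\<^esub> v \<Longrightarrow> tr u \<noteq> tr v"
    and cross: "\<And>u v u' v'. {u, v, u', v'} \<subseteq> verts G \<Longrightarrow> u \<rightarrow>\<^bsub>G\<^esub> v \<Longrightarrow> u' \<rightarrow>\<^bsub>G\<^esub> v' \<Longrightarrow>
      tr u = tr u' \<Longrightarrow> u \<noteq> u' \<Longrightarrow> key u \<le> key u' \<Longrightarrow>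
      tr v = tr v' \<Longrightarrow> v \<noteq> v' \<Longrightarrow> key v' \<le> key v \<Longrightarrow> False"
  shows "\<exists>T. track_layout G k T"
proof -
  obtain xs where xs: "distinct xs" "set xs = verts G"
    using finite_distinct_list assms(1) by blast
  define track where "track t = sort_key key (filter (\<lambda>v. tr v = t) xs)" for t
  have set_track: "set (track t) = {v \<in> verts G. tr v = t}" for t
    by (auto simp: track_def xs)
  have before: "x \<in> verts G" "tr x = t" "y \<in> verts G" "tr y = t" "x \<noteq> y" "key x \<le> key y"
    if "before_in (track t) x y" for t x y
    using before_in_sort_keyD[OF that[unfolded track_def]] xs by auto
  have dist: "distinct (concat (map track ts))" if "distinct ts" for ts
    using that
  proof (induction ts)
    case (Cons t ts)
    then show ?case using xs by (auto simp: set_track) (simp add: track_def)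
  qed simp
  have "track_layout G k (map track [0..<k])"
    unfolding track_layout_def
  proof (intro conjI)
    show "distinct (concat (map track [0..<k]))"
      by (intro dist) simp
    show "set (concat (map track [0..<k])) = verts G"
      using tr by (auto simp: set_track)
    show "\<forall>t \<in> set (map track [0..<k]). \<forall>u \<in> set t. \<forall>v \<in> set t. \<not> u \<rightarrow>\<^bsub>G\<^esub> v"
      using indep by (fastforce simp: set_track)
    show "\<forall>i < k. \<forall>j < k. i \<noteq> j \<longrightarrow>
        \<not> (\<exists>u v u' v'. u \<rightarrow>\<^bsub>G\<^esub> v \<and> u' \<rightarrow>\<^bsub>G\<^esub> v' \<and>
             before_in (map track [0..<k] ! i) u u' \<and> before_in (map track [0..<k] ! j) v' v)"
    proof (intro allI impI notI, elim exE conjE)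
      fix i j u v u' v'
      assume e: "u \<rightarrow>\<^bsub>G\<^esub> v" "u' \<rightarrow>\<^bsub>G\<^esub> v'" and "i < k" "j < k"
        "before_in (map track [0..<k] ! i) u u'" "before_in (map track [0..<k] ! j) v' v"
      then have b: "before_in (track i) u u'" "before_in (track j) v' v"
        by simp_all
      show False
        using cross[of u v u' v'] e before[OF b(1)] before[OF b(2)] by auto
    qed
  qed simp
  then show ?thesis by blast
qed

theorem lemma9:
  fixes G :: "('a, 'b) pre_digraph" and l :: nat
  assumes "graph G"
    and "layered_pathwidth G = l"
  shows "track_number G \<le> 3 * l"
proof -
  interpret graph G by (rule assms(1))
  obtain B L where pd: "path_decomposition G B" and lay: "layering G L"
    and width: "\<And>X Y. X \<in> set B \<Longrightarrow> Y \<in> set L \<Longrightarrow> card (X \<inter> Y) \<le> l"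
    using layered_width_at_most_layered_pathwidth[OF assms(1)] assms(2)
    unfolding layered_width_at_most_def by blast
  have "\<forall>v \<in> verts G. \<exists>i j. i \<le> j \<and> {k. k < length B \<and> v \<in> B ! k} = {i..j}"
    using pd unfolding path_decomposition_def by blast
  then obtain a b where ab: "\<And>v. v \<in> verts G \<Longrightarrow> a v \<le> b v"
    "\<And>v. v \<in> verts G \<Longrightarrow> {k. k < length B \<and> v \<in> B ! k} = {a v..b v}"
    by metis
  have bag: "k \<in> {a v..b v} \<longleftrightarrow> k < length B \<and> v \<in> B ! k" if "v \<in> verts G" for k v
    using ab(2)[OF that] by blast
  have a_less: "a v < length B" if "v \<in> verts G" for v
    using bag[OF that, of "a v"] ab(1)[OF that] by simp
  have meet: "\<exists>k. k \<in> {a u..b u} \<and> k \<in> {a v..b v}" if "u \<rightarrow>\<^bsub>G\<^esub> v" for u v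
  proof -
    have "\<exists>X \<in> set B. u \<in> X \<and> v \<in> X"
      using pd that unfolding path_decomposition_def by simp
    then obtain k where "k < length B" "u \<in> B ! k" "v \<in> B ! k"
      by (auto simp: in_set_conv_nth)
    then show ?thesis
      using bag adj_in_verts[OF that] by blast
  qed

  have "\<forall>v \<in> verts G. \<exists>i. i < length L \<and> v \<in> L ! i"
    using lay unfolding layering_def by (metis UnionE in_set_conv_nth)
  then obtain h where h: "\<And>v. v \<in> verts G \<Longrightarrow> h v < length L"
    "\<And>v. v \<in> verts G \<Longrightarrow> v \<in> L ! h v"
    by metis
  have h_adj: "h u = h v \<or> h v = Suc (h u) \<or> h u = Suc (h v)" if "u \<rightarrow>\<^bsub>G\<^esub> v" for u v
  proof -
    have "u \<in> verts G" "v \<in> verts G"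
      using adj_in_verts[OF that] by auto
    then show ?thesis
      using lay that h[of u] h[of v] unfolding layering_def by metis
  qed

  have "\<exists>c. (\<forall>v \<in> {v \<in> verts G. h v = i}. c v < l) \<and>
    (\<forall>u \<in> {v \<in> verts G. h v = i}. \<forall>v \<in> {v \<in> verts G. h v = i}.
      u \<noteq> v \<longrightarrow> c u = c v \<longrightarrow> {a u..b u} \<inter> {a v..b v} = {})" for i
  proof (rule interval_colouring)
    fix k
    let ?M = "{v \<in> {v \<in> verts G. h v = i}. k \<in> {a v..b v}}"
    show "card ?M \<le> l"
    proof (cases "?M = {}")
      case False
      then have ik: "i < length L" "k < length B"
        using h bag by auto
      have "finite (B ! k)"
        using pd ik finite_verts unfolding path_decomposition_def
        by (meson finite_subset nth_mem)
      moreover have "?M \<subseteq> B ! k \<inter> L ! i"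
        using h bag by auto
      ultimately have "card ?M \<le> card (B ! k \<inter> L ! i)"
        by (intro card_mono) auto
      also have "\<dots> \<le> l"
        using width ik by simp
      finally show ?thesis .
    qed (simp only: card.empty)
  qed (use ab in auto)
  then obtain c where c: "\<And>i v. v \<in> verts G \<Longrightarrow> h v = i \<Longrightarrow> c i v < l"
    "\<And>i u v. u \<in> verts G \<Longrightarrow> v \<in> verts G \<Longrightarrow> h u = i \<Longrightarrow> h v = i \<Longrightarrow> u \<noteq> v \<Longrightarrow>
       c i u = c i v \<Longrightarrow> {a u..b u} \<inter> {a v..b v} = {}"
    by (atomize_elim, simp only: mem_Collect_eq Ball_def) metis
  define col where "col v = c (h v) v" for v
  have col_less: "col v < l" if "v \<in> verts G" for v
    using c(1) that by (simp add: col_def)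
  have col_disjoint: "{a u..b u} \<inter> {a v..b v} = {}"
    if "u \<in> verts G" "v \<in> verts G" "h u = h v" "u \<noteq> v" "col u = col v" for u v
    using c(2)[of u v "h v"] that by (simp add: col_def)

  define tr where "tr v = 3 * col v + h v mod 3" for v
  have tr_eq: "col u = col v" "h u mod 3 = h v mod 3" if "tr u = tr v" for u v
  proof -
    have "tr w div 3 = col w" "tr w mod 3 = h w mod 3" for w
      by (simp_all add: tr_def)
    then show "col u = col v" "h u mod 3 = h v mod 3"
      using that by metis+
  qed
  have gap: "p = q \<or> p + 3 \<le> q \<or> q + 3 \<le> p" if "p mod 3 = q mod 3" for p q :: nat
    using that div_mult_mod_eq[of p 3] div_mult_mod_eq[of q 3]
    by (cases "p div 3" "q div 3" rule: linorder_cases) linarith+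
  \<comment> \<open>Since \<open>a v < length B\<close>, this encodes the lexicographic order of layer and left endpoint.\<close>
  define key where "key v = h v * length B + a v" for v
  have key_le: "h u \<le> h v" "h u = h v \<Longrightarrow> a u \<le> a v"
    if "key u \<le> key v" "u \<in> verts G" "v \<in> verts G" for u v
  proof -
    show "h u \<le> h v"
    proof (rule ccontr)
      assume "\<not> h u \<le> h v"
      then have "Suc (h v) * length B \<le> h u * length B"
        by (intro mult_le_mono1) simp
      then show False
        using that(1) a_less[OF that(3)] by (simp add: key_def)
    qed
    show "h u = h v \<Longrightarrow> a u \<le> a v"
      using that(1) by (simp add: key_def)
  qed
  have left_of: "b u < a v"
    if "u \<in> verts G" "v \<in> verts G" "h u = h v" "u \<noteq> v" "tr u = tr v" "key u \<le> key v" for u v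
  proof -
    have "a u \<le> a v"
      using key_le(2) that by blast
    moreover have "a v \<notin> {a u..b u}"
    proof
      assume "a v \<in> {a u..b u}"
      moreover have "a v \<in> {a v..b v}"
        using ab(1)[OF that(2)] by simp
      ultimately show False
        using col_disjoint[OF that(1-4) tr_eq(1)[OF that(5)]] by blast
    qed
    ultimately show ?thesis by simp
  qed

  have "\<exists>T. track_layout G (3 * l) T"
  proof (rule track_layout_of_ordered_colouring[where tr = tr and key = key])
    show "tr v < 3 * l" if "v \<in> verts G" for v
      using col_less[OF that] unfolding tr_def by presburger
  next
    fix u v assume uv: "u \<in> verts G" "v \<in> verts G" "u \<rightarrow>\<^bsub>G\<^esub> v"
    show "tr u \<noteq> tr v"
    proof
      assume eq: "tr u = tr v"
      have "h u = h v"
        using h_adj[OF uv(3)] gap[OF tr_eq(2)[OF eq]] by linarith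
      moreover have "u \<noteq> v"
        using uv(3) adj_not_same by blast
      ultimately show False
        using col_disjoint[OF uv(1,2) _ _ tr_eq(1)[OF eq]] meet[OF uv(3)] by blast
    qed
  next
    fix u v u' v'
    assume V: "{u, v, u', v'} \<subseteq> verts G" and uv: "u \<rightarrow>\<^bsub>G\<^esub> v" and uv': "u' \<rightarrow>\<^bsub>G\<^esub> v'"
      and u: "tr u = tr u'" "u \<noteq> u'" "key u \<le> key u'"
      and v: "tr v = tr v'" "v \<noteq> v'" "key v' \<le> key v"
    have le: "h u \<le> h u'" "h v' \<le> h v"
      using key_le(1) u(3) v(3) V by auto
    have "h u = h u' \<or> h u + 3 \<le> h u'" "h v' = h v \<or> h v' + 3 \<le> h v"
      using gap[OF tr_eq(2)[OF u(1)]] gap[OF tr_eq(2)[OF v(1)]] le by auto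
    \<comment> \<open>Adjacent vertices are at most one layer apart, so a gap of 3 in one track would
      reverse the order of the layers in the other.\<close>
    then have "h u = h u'" "h v = h v'"
      using le h_adj[OF uv] h_adj[OF uv'] by linarith+
    then have "b u < a u'" "b v' < a v"
      using left_of[of u u'] left_of[of v' v] u v V by auto
    then show False
      using meet[OF uv] meet[OF uv'] by fastforce
  qed simp
  then show ?thesis
    unfolding track_number_def by (rule Least_le)
qed

end
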